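(* Let $m\ge 2$, $n\ge 1$, $N=\{1,\dots,n\}$, and let $\mathcal{A}=(a_{i_1i_2\cdots i_m})\in\mathbb{C}^{[m,n]}$ be a complex tensor of order $m$ and dimension $n$. Suppose that for each $i\in N$, either $$|a_{i\cdots i}|>r_i(\mathcal{A})$$ or $$|a_{j\cdots j}|<2|a_{ji\cdots i}|-r_j(\mathcal{A})\quad\text{for some } j\in N,\ j\neq i.$$ Then $\det(\mathcal{A})\neq 0$.
   Context: A tensor $\mathcal{A}=(a_{i_1\cdots i_m})\in\mathbb{C}^{[m,n]}$ of order $m$ and dimension $n$ is a family of complex numbers $a_{i_1\cdots i_m}$ indexed by $(i_1,\dots,i_m)\in N^m$, $N=\{1,\dots,n\}$. The entry $a_{j i\cdots i}$ is the one with first index $j$ and the remaining $m-1$ indices equal to $i$; $a_{i\cdots i}$ has all $m$ indices equal to $i$. For $i\in N$, $r_i(\mathcal{A})=\sum |a_{ii_2\cdots i_m}|$, the sum being over all $(i_2,\dots,i_m)\in N^{m-1}$ with $(i_2,\dots,i_m)\neq(i,\dots,i)$. For $x\in\mathbb{C}^n$, $\mathcal{A}x^{m-1}\in\mathbb{C}^n$ is given by $(\mathcal{A}x^{m-1})_i=\sum_{i_2,\dots,i_m\in N}a_{ii_2\cdots i_m}x_{i_2}\cdots x_{i_m}$. The determinant $\det(\mathcal{A})$ is the resultant of the ordered system of $n$ homogeneous equations $\mathcal{A}x^{m-1}=0$ in the $n$ variables $x_1,\dots,x_n$. It is a known fact that $\det(\mathcal{A})=0$ if and only if $0$ is an eigenvalue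 of $\mathcal{A}$, i.e. if and only if there is a nonzero $x\in\mathbb{C}^n$ with $\mathcal{A}x^{m-1}=0$. *)

theory Defs
  imports Complex_Main "HOL-Library.Poly_Mapping"
begin

text \<open>
  A polynomial with coefficients in \<open>'a\<close> and variables in \<open>'v\<close> is a finitely supported map from
  monomials (finitely supported exponent vectors) to coefficients.
\<close>

type_synonym 'v monom = "'v \<Rightarrow>\<^sub>0 nat"
type_synonym ('v, 'a) mpol = "'v monom \<Rightarrow>\<^sub>0 'a"

definition mdeg :: "'v monom \<Rightarrow> nat" where
  "mdeg \<mu> = (\<Sum>v\<in>Poly_Mapping.keys \<mu>. Poly_Mapping.lookup \<mu> v)"

definition tdeg :: "('v, 'a::zero) mpol \<Rightarrow> nat" where
  "tdeg p = Max (insert 0 (mdeg ` Poly_Mapping.keys p))"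

definition const :: "'a::zero \<Rightarrow> ('v, 'a) mpol" where
  "const c = Poly_Mapping.single 0 c"

definition var :: "'v \<Rightarrow> ('v, 'a::{zero,one}) mpol" where
  "var v = Poly_Mapping.single (Poly_Mapping.single v 1) 1"

definition peval :: "('v \<Rightarrow> 'b::comm_ring_1) \<Rightarrow> ('v, int) mpol \<Rightarrow> 'b" where
  "peval c p = (\<Sum>\<mu>\<in>Poly_Mapping.keys p. of_int (Poly_Mapping.lookup p \<mu>) *
      (\<Prod>v\<in>Poly_Mapping.keys \<mu>. c v ^ Poly_Mapping.lookup \<mu> v))"

text \<open>
  The resultant of \<open>n\<close> forms of degree \<open>d\<close> in \<open>x\<^sub>1, \<dots>, x\<^sub>n\<close> is a polynomial with integer
  coefficients in indeterminates \<open>u\<^bsub>(i,\<alpha>)\<^esub>\<close>, where \<open>u\<^bsub>(i,\<alpha>)\<^esub>\<close> stands for the coefficient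
  of the monomial \<open>x\<^sup>\<alpha>\<close> in the \<open>i\<close>-th form.
\<close>

type_synonym coeff_var = "nat \<times> nat monom"

definition monoms :: "nat \<Rightarrow> nat \<Rightarrow> nat monom set" where
  "monoms n d = {\<alpha>. Poly_Mapping.keys \<alpha> \<subseteq> {1..n} \<and> mdeg \<alpha> = d}"

lemma finite_monoms: "finite (monoms n d)"
proof (rule inj_on_finite)
  show "inj_on Poly_Mapping.lookup (monoms n d)"
    by (rule inj_onI) (simp add: poly_mapping_eqI)
  show "Poly_Mapping.lookup ` monoms n d \<subseteq>
      {f. \<forall>i. (i \<in> {1..n} \<longrightarrow> f i \<in> {0..d}) \<and> (i \<notin> {1..n} \<longrightarrow> f i = 0)}"
  proof (clarify)
    fix \<alpha> i assume a: "\<alpha> \<in> monoms n d"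
    have "Poly_Mapping.lookup \<alpha> i \<le> d"
    proof (cases "i \<in> Poly_Mapping.keys \<alpha>")
      case True
      have "Poly_Mapping.lookup \<alpha> i \<le> mdeg \<alpha>"
        unfolding mdeg_def using True by (intro member_le_sum) auto
      then show ?thesis using a by (simp add: monoms_def)
    qed (simp add: in_keys_iff)
    then show "(i \<in> {1..n} \<longrightarrow> Poly_Mapping.lookup \<alpha> i \<in> {0..d}) \<and>
        (i \<notin> {1..n} \<longrightarrow> Poly_Mapping.lookup \<alpha> i = 0)"
      using a by (auto simp: monoms_def in_keys_iff subset_iff)
  qed
  show "finite {f :: nat \<Rightarrow> nat. \<forall>i. (i \<in> {1..n} \<longrightarrow> f i \<in> {0..d}) \<and> (i \<notin> {1..n} \<longrightarrow> f i = 0)}"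
    by (rule finite_set_of_finite_funs) auto
qed

definition generic_form :: "nat \<Rightarrow> nat \<Rightarrow> nat \<Rightarrow> (nat, (coeff_var, int) mpol) mpol" where
  "generic_form n d i = (\<Sum>\<alpha>\<in>monoms n d. Poly_Mapping.single \<alpha> (var (i, \<alpha>)))"

text \<open>
  \<open>T \<in> \<int>[u]\<close> is an inertia form (Hurwitz) of the generic forms \<open>F\<^sub>1, \<dots>, F\<^sub>n\<close> if, for some \<open>k\<close>,
  the products \<open>x\<^sup>\<alpha> T\<close> with \<open>x\<^sup>\<alpha>\<close> of degree \<open>k\<close> all lie in the ideal generated by
  \<open>F\<^sub>1, \<dots>, F\<^sub>n\<close> in \<open>\<int>[u][x]\<close>.
\<close>

definition inertia_form :: "nat \<Rightarrow> nat \<Rightarrow> (coeff_var, int) mpol \<Rightarrow> bool" where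
  "inertia_form n d T \<longleftrightarrow> (\<exists>k. \<forall>\<alpha>\<in>monoms n k.
      \<exists>q. Poly_Mapping.single \<alpha> T = (\<Sum>i\<in>{1..n}. q i * generic_form n d i))"

text \<open>
  The resultant is the greatest common divisor of the inertia forms (they form a principal ideal),
  normalised to take the value \<open>1\<close> at the system \<open>x\<^sub>1\<^sup>d, \<dots>, x\<^sub>n\<^sup>d\<close>. In the factorial domain
  \<open>\<int>[u]\<close> a common divisor of maximal degree agrees with the greatest common divisor up to an integer
  factor, and the normalisation forces that factor, including its sign; so the polynomial
  satisfying this predicate is unique.
\<close>

definition is_resultant :: "nat \<Rightarrow> nat \<Rightarrow> (coeff_var, int) mpol \<Rightarrow> bool" where
  "is_resultant n d R \<longleftrightarrow>
     (\<forall>T. inertia_form n d T \<longrightarrow> R dvd T) \<and>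
     (\<forall>S. (\<forall>T. inertia_form n d T \<longrightarrow> S dvd T) \<longrightarrow> tdeg S \<le> tdeg R) \<and>
     peval (\<lambda>(i, \<alpha>). if \<alpha> = Poly_Mapping.single i d then 1 else 0 :: int) R = 1"

definition resultant_poly :: "nat \<Rightarrow> nat \<Rightarrow> (coeff_var, int) mpol" where
  "resultant_poly n d = (SOME R. is_resultant n d R)"

definition form_resultant :: "nat \<Rightarrow> nat \<Rightarrow> (nat \<Rightarrow> (nat, complex) mpol) \<Rightarrow> complex" where
  "form_resultant n d F = peval (\<lambda>(i, \<alpha>). Poly_Mapping.lookup (F i) \<alpha>) (resultant_poly n d)"

text \<open>
  A tensor of order \<open>m\<close> and dimension \<open>n\<close> is given by its entries \<open>A [i\<^sub>1, \<dots>, i\<^sub>m]\<close> for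
  \<open>[i\<^sub>1, \<dots>, i\<^sub>m] \<in> indices n m\<close>; the values of \<open>A\<close> on other lists are irrelevant.
\<close>

type_synonym tensor = "nat list \<Rightarrow> complex"

definition indices :: "nat \<Rightarrow> nat \<Rightarrow> nat list set" where
  "indices n k = {is. set is \<subseteq> {1..n} \<and> length is = k}"

lemma finite_indices: "finite (indices n k)"
  unfolding indices_def by (rule finite_lists_length_eq) simp

definition row_sum :: "nat \<Rightarrow> nat \<Rightarrow> tensor \<Rightarrow> nat \<Rightarrow> real" where
  "row_sum m n A i = (\<Sum>is\<in>indices n (m - 1) - {replicate (m - 1) i}. cmod (A (i # is)))"

text \<open>The \<open>i\<close>-th component of \<open>A x\<^sup>m\<^sup>-\<^sup>1\<close> as a form in the indeterminates \<open>x\<^sub>1, \<dots>, x\<^sub>n\<close>.\<close>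

definition tensor_form :: "nat \<Rightarrow> nat \<Rightarrow> tensor \<Rightarrow> nat \<Rightarrow> (nat, complex) mpol" where
  "tensor_form m n A i = (\<Sum>is\<in>indices n (m - 1). const (A (i # is)) * (\<Prod>j\<leftarrow>is. var j))"

definition tensor_det :: "nat \<Rightarrow> nat \<Rightarrow> tensor \<Rightarrow> complex" where
  "tensor_det m n A = form_resultant n (m - 1) (tensor_form m n A)"

end

theory Submission
  imports "Jordan_Normal_Form.Determinant" "HOL-Library.Product_Lexorder" Defs
begin

text \<open>
  Write \<open>F\<^sub>1, \<dots>, F\<^sub>n\<close> for the forms of degree \<open>d = m - 1\<close> given by the tensor. Both alternatives
  of the hypothesis on \<open>i\<close> say the same thing: some form \<open>F\<^bsub>\<sigma>(i)\<^esub>\<close> has a coefficient at \<open>x\<^sub>i\<^sup>d\<close>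
  that exceeds in modulus the sum of the moduli of its other coefficients (\<open>\<sigma>(i) = i\<close> in the first
  alternative, \<open>\<sigma>(i) = j\<close> in the second). This makes a Macaulay matrix of the system strictly
  diagonally dominant, hence nonsingular.

  A monomial \<open>x\<^sup>\<alpha>\<close> of degree \<open>n (d - 1) + 1\<close> contains, by the pigeonhole principle, some variable
  \<open>x\<^sub>i\<close> with exponent at least \<open>d\<close>. The row \<open>\<alpha>\<close> of the Macaulay matrix lists the coefficients of
  \<open>(x\<^sup>\<alpha> / x\<^sub>i\<^sup>d) F\<^bsub>\<sigma>(i)\<^esub>\<close>, so its diagonal entry is the coefficient of \<open>F\<^bsub>\<sigma>(i)\<^esub>\<close> at \<open>x\<^sub>i\<^sup>d\<close>
  and its other nonzero entries are the other coefficients of \<open>F\<^bsub>\<sigma>(i)\<^esub>\<close>. Formed with the generic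
  forms, the matrix has a determinant \<open>T \<in> \<int>[u]\<close> with three properties.

  \<^item> \<open>T\<close> is an inertia form, because multiplying by the adjugate writes each \<open>x\<^sup>\<gamma> T\<close> as a
    combination of the rows (\<open>det_inertia_form\<close>).
  \<^item> \<open>T\<close> does not vanish at a system that is dominated as above (\<open>peval_det_nonzero\<close>).
  \<^item> For \<open>\<sigma> = id\<close>, \<open>T\<close> has the value \<open>1\<close> at \<open>x\<^sub>1\<^sup>d, \<dots>, x\<^sub>n\<^sup>d\<close>, where the matrix is the identity
    (\<open>peval_det_powers\<close>).

  The last property shows that a resultant exists (\<open>ex_is_resultant\<close>): common divisors of the inertia
  forms divide \<open>T \<noteq> 0\<close>, so their degrees are bounded and one of maximal degree exists; its value at
  the pure powers divides \<open>1\<close>, so up to sign it is normalised. The resultant then divides \<open>T\<close> for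
  every \<open>\<sigma>\<close>, so it cannot vanish at a dominated system (\<open>form_resultant_nonzero\<close>).
\<close>

section \<open>Evaluation of integer polynomials\<close>

definition monom_eval :: "('v \<Rightarrow> 'b::comm_ring_1) \<Rightarrow> 'v monom \<Rightarrow> 'b" where
  "monom_eval c \<mu> = (\<Prod>v\<in>Poly_Mapping.keys \<mu>. c v ^ Poly_Mapping.lookup \<mu> v)"

lemma monom_eval_superset:
  assumes "finite V" "Poly_Mapping.keys \<mu> \<subseteq> V"
  shows "monom_eval c \<mu> = (\<Prod>v\<in>V. c v ^ Poly_Mapping.lookup \<mu> v)"
  unfolding monom_eval_def
  by (rule prod.mono_neutral_left) (use assms in \<open>auto simp: in_keys_iff\<close>)

lemma monom_eval_add: "monom_eval c (\<mu> + \<nu>) = monom_eval c \<mu> * monom_eval c \<nu>"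
proof -
  let ?V = "Poly_Mapping.keys \<mu> \<union> Poly_Mapping.keys \<nu>"
  have "monom_eval c (\<mu> + \<nu>) = (\<Prod>v\<in>?V. c v ^ Poly_Mapping.lookup (\<mu> + \<nu>) v)"
    by (rule monom_eval_superset) (auto dest: subsetD[OF keys_add])
  also have "\<dots> = (\<Prod>v\<in>?V. c v ^ Poly_Mapping.lookup \<mu> v) * (\<Prod>v\<in>?V. c v ^ Poly_Mapping.lookup \<nu> v)"
    by (simp add: lookup_add power_add prod.distrib)
  finally show ?thesis
    by (simp add: monom_eval_superset[of ?V \<mu>] monom_eval_superset[of ?V \<nu>])
qed

lemma peval_superset:
  assumes "finite B" "Poly_Mapping.keys p \<subseteq> B"
  shows "peval c p = (\<Sum>\<mu>\<in>B. of_int (Poly_Mapping.lookup p \<mu>) * monom_eval c \<mu>)"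
  unfolding peval_def monom_eval_def[symmetric]
  by (rule sum.mono_neutral_left) (use assms in \<open>auto simp: in_keys_iff\<close>)

lemma peval_add: "peval c (p + q) = peval c p + peval c q"
proof -
  let ?B = "Poly_Mapping.keys p \<union> Poly_Mapping.keys q"
  have "peval c (p + q) = (\<Sum>\<mu>\<in>?B. of_int (Poly_Mapping.lookup (p + q) \<mu>) * monom_eval c \<mu>)"
    by (rule peval_superset) (auto dest: subsetD[OF keys_add])
  then show ?thesis
    by (simp add: lookup_add distrib_right sum.distrib
        peval_superset[of ?B p] peval_superset[of ?B q])
qed

lemma peval_zero: "peval c 0 = 0"
  by (simp add: peval_def)

lemma peval_sum: "peval c (\<Sum>x\<in>X. f x) = (\<Sum>x\<in>X. peval c (f x))"
  by (induction X rule: infinite_finite_induct) (simp_all add: peval_zero peval_add)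

lemma peval_single: "peval c (Poly_Mapping.single \<mu> a) = of_int a * monom_eval c \<mu>"
  by (subst peval_superset[of "{\<mu>}"]) auto

lemma peval_var: "peval c (var v) = c v"
  by (simp add: var_def peval_single monom_eval_def)

lemma sum_of_singles:
  "(\<Sum>\<mu>\<in>Poly_Mapping.keys p. Poly_Mapping.single \<mu> (Poly_Mapping.lookup p \<mu>)) = p"
  by (rule poly_mapping_eqI) (simp add: lookup_sum lookup_single when_def in_keys_iff)

lemma peval_mult: "peval c (p * q) = peval c p * peval c q"
proof -
  let ?s = "\<lambda>p \<mu>. Poly_Mapping.single \<mu> (Poly_Mapping.lookup p \<mu>)"
  have "peval c (p * q) = peval c ((\<Sum>\<mu>\<in>Poly_Mapping.keys p. ?s p \<mu>) * (\<Sum>\<nu>\<in>Poly_Mapping.keys q. ?s q \<nu>))"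
    by (simp only: sum_of_singles)
  also have "\<dots> = (\<Sum>\<mu>\<in>Poly_Mapping.keys p. \<Sum>\<nu>\<in>Poly_Mapping.keys q. peval c (?s p \<mu>) * peval c (?s q \<nu>))"
    by (simp add: sum_product peval_sum mult_single peval_single monom_eval_add ac_simps)
  also have "\<dots> = peval c (\<Sum>\<mu>\<in>Poly_Mapping.keys p. ?s p \<mu>) * peval c (\<Sum>\<nu>\<in>Poly_Mapping.keys q. ?s q \<nu>)"
    by (simp only: sum_product peval_sum)
  finally show ?thesis
    by (simp only: sum_of_singles)
qed

lemma peval_one: "peval c 1 = 1"
  using peval_single[of c 0 1] by (simp add: monom_eval_def)

interpretation peval: comm_ring_hom "peval c"
  by unfold_locales (simp_all add: peval_zero peval_one peval_add peval_mult)

section \<open>The total degree of a product\<close>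

lemma mdeg_superset:
  assumes "finite V" "Poly_Mapping.keys \<mu> \<subseteq> V"
  shows "mdeg \<mu> = (\<Sum>v\<in>V. Poly_Mapping.lookup \<mu> v)"
  unfolding mdeg_def
  by (rule sum.mono_neutral_left) (use assms in \<open>auto simp: in_keys_iff\<close>)

lemma mdeg_add: "mdeg (\<mu> + \<nu>) = mdeg \<mu> + mdeg \<nu>"
proof -
  let ?V = "Poly_Mapping.keys \<mu> \<union> Poly_Mapping.keys \<nu>"
  have "mdeg (\<mu> + \<nu>) = (\<Sum>v\<in>?V. Poly_Mapping.lookup (\<mu> + \<nu>) v)"
    by (rule mdeg_superset) (auto dest: subsetD[OF keys_add])
  then show ?thesis
    by (simp add: lookup_add sum.distrib mdeg_superset[of ?V \<mu>] mdeg_superset[of ?V \<nu>])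
qed

lemma mdeg_single [simp]: "mdeg (Poly_Mapping.single v k) = k"
  by (simp add: mdeg_def)

lemma mdeg_le_tdeg: "\<mu> \<in> Poly_Mapping.keys p \<Longrightarrow> mdeg \<mu> \<le> tdeg p"
  by (simp add: tdeg_def)

text \<open>
  The top homogeneous part of \<open>p\<close> is split off so that the degree of a product can be read off from
  the product of the two top parts, which is nonzero in a domain.
\<close>

lemma split_top_degree:
  fixes p :: "('v, 'a::comm_monoid_add) mpol"
  assumes "p \<noteq> 0"
  obtains p1 p2 where "p = p1 + p2" "p1 \<noteq> 0"
    "\<And>\<mu>. \<mu> \<in> Poly_Mapping.keys p1 \<Longrightarrow> mdeg \<mu> = tdeg p"
    "\<And>\<mu>. \<mu> \<in> Poly_Mapping.keys p2 \<Longrightarrow> mdeg \<mu> < tdeg p"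
proof
  let ?K = "Poly_Mapping.keys p"
  let ?s = "\<lambda>\<mu>. Poly_Mapping.single \<mu> (Poly_Mapping.lookup p \<mu>)"
  define top where "top = {\<mu>\<in>?K. mdeg \<mu> = tdeg p}"
  have top: "finite top" "top \<subseteq> ?K" by (auto simp: top_def)
  have keys: "Poly_Mapping.keys (sum ?s X) = X" if "X \<subseteq> ?K" for X
  proof -
    have "finite X" using that finite_keys finite_subset by blast
    then show ?thesis
      using that by (auto simp: in_keys_iff lookup_sum lookup_single when_def split: if_splits)
  qed
  have "sum ?s top + sum ?s (?K - top) = sum ?s ?K"
    by (rule sum.subset_diff[symmetric, THEN trans[OF add.commute]]) (use top in auto)
  then show "p = sum ?s top + sum ?s (?K - top)"
    by (simp only: sum_of_singles)
  have "?K \<noteq> {}" using assms by (metis sum_of_singles sum.empty)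
  then have "tdeg p \<in> mdeg ` ?K"
    unfolding tdeg_def using Max_in[of "mdeg ` ?K"] by (simp add: Max_insert)
  then have "top \<noteq> {}" by (auto simp: top_def)
  then show "sum ?s top \<noteq> 0" using keys[OF top(2)] by auto
  show "mdeg \<mu> = tdeg p" if "\<mu> \<in> Poly_Mapping.keys (sum ?s top)" for \<mu>
    using that keys[OF top(2)] by (auto simp: top_def)
  show "mdeg \<mu> < tdeg p" if "\<mu> \<in> Poly_Mapping.keys (sum ?s (?K - top))" for \<mu>
    using that keys[of "?K - top"] mdeg_le_tdeg[of \<mu> p] by (auto simp: top_def)
qed

text \<open>
  A monomial of the product of the top parts cannot be cancelled, because all other contributions to
  \<open>p * q\<close> have smaller degree. The linear order on the variables provides the domain structure: it
  induces a monomial order, under which leading terms multiply.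
\<close>

lemma tdeg_mult_ge:
  fixes p q :: "('v::linorder, 'a::idom) mpol"
  assumes "p \<noteq> 0" "q \<noteq> 0"
  shows "tdeg p + tdeg q \<le> tdeg (p * q)"
proof -
  obtain p1 p2 where p: "p = p1 + p2" "p1 \<noteq> 0"
    "\<And>\<mu>. \<mu> \<in> Poly_Mapping.keys p1 \<Longrightarrow> mdeg \<mu> = tdeg p"
    "\<And>\<mu>. \<mu> \<in> Poly_Mapping.keys p2 \<Longrightarrow> mdeg \<mu> < tdeg p"
    using split_top_degree[OF assms(1)] by blast
  obtain q1 q2 where q: "q = q1 + q2" "q1 \<noteq> 0"
    "\<And>\<mu>. \<mu> \<in> Poly_Mapping.keys q1 \<Longrightarrow> mdeg \<mu> = tdeg q"
    "\<And>\<mu>. \<mu> \<in> Poly_Mapping.keys q2 \<Longrightarrow> mdeg \<mu> < tdeg q"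
    using split_top_degree[OF assms(2)] by blast
  have "p1 * q1 \<noteq> 0" using p(2) q(2) by simp
  then obtain \<kappa> where \<kappa>: "\<kappa> \<in> Poly_Mapping.keys (p1 * q1)"
    by (metis sum_of_singles sum.empty ex_in_conv)
  then have deg: "mdeg \<kappa> = tdeg p + tdeg q"
    using keys_mult[of p1 q1] p(3) q(3) by (fastforce simp: mdeg_add)
  have low: "Poly_Mapping.lookup (f * g) \<kappa> = 0"
    if "\<And>\<mu> \<nu>. \<mu> \<in> Poly_Mapping.keys f \<Longrightarrow> \<nu> \<in> Poly_Mapping.keys g \<Longrightarrow> mdeg \<mu> + mdeg \<nu> < tdeg p + tdeg q"
    for f :: "('v, 'a) mpol" and g
  proof (rule ccontr)
    assume "Poly_Mapping.lookup (f * g) \<kappa> \<noteq> 0"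
    then have "\<kappa> \<in> Poly_Mapping.keys (f * g)" by (simp add: in_keys_iff)
    with keys_mult[of f g] obtain \<mu> \<nu> where
      "\<kappa> = \<mu> + \<nu>" "\<mu> \<in> Poly_Mapping.keys f" "\<nu> \<in> Poly_Mapping.keys g"
      by blast
    then show False using that[of \<mu> \<nu>] deg by (simp add: mdeg_add)
  qed
  have "p * q = p1 * q1 + (p1 * q2 + (p2 * q1 + p2 * q2))"
    by (simp add: p(1) q(1) algebra_simps)
  moreover have "Poly_Mapping.lookup (p1 * q2) \<kappa> = 0"
    by (rule low) (simp add: p(3) q(4))
  moreover have "Poly_Mapping.lookup (p2 * q1) \<kappa> = 0"
    by (rule low) (simp add: p(4) q(3))
  moreover have "Poly_Mapping.lookup (p2 * q2) \<kappa> = 0"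
    by (rule low) (simp add: p(4) q(4) add_strict_mono)
  ultimately have "Poly_Mapping.lookup (p * q) \<kappa> = Poly_Mapping.lookup (p1 * q1) \<kappa>"
    by (simp add: lookup_add)
  then have "\<kappa> \<in> Poly_Mapping.keys (p * q)" using \<kappa> by (simp add: in_keys_iff)
  then show ?thesis using mdeg_le_tdeg[of \<kappa>] deg by simp
qed

lemma tdeg_le_if_dvd:
  fixes S T :: "('v::linorder, 'a::idom) mpol"
  assumes "S dvd T" "T \<noteq> 0"
  shows "tdeg S \<le> tdeg T"
proof -
  obtain Q where "T = S * Q" using assms(1) by blast
  with tdeg_mult_ge[of S Q] assms(2) show ?thesis by auto
qed

lemma tdeg_uminus: "tdeg (- p) = tdeg (p :: ('v, 'a::ab_group_add) mpol)"
proof -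
  have "Poly_Mapping.keys (- p) = Poly_Mapping.keys p" by (auto simp: in_keys_iff)
  then show ?thesis by (simp add: tdeg_def)
qed

section \<open>Diagonally dominant matrices\<close>

text \<open>
  The classical argument: in a kernel vector, the row of a component of maximal modulus is violated.
\<close>

lemma det_diagonally_dominant_nonzero:
  fixes M :: "'a::real_normed_field mat"
  assumes M: "M \<in> carrier_mat N N"
    and dom: "\<And>a. a < N \<Longrightarrow> (\<Sum>b\<in>{0..<N} - {a}. norm (M $$ (a, b))) < norm (M $$ (a, a))"
  shows "det M \<noteq> 0"
proof
  assume "det M = 0"
  then obtain x where x: "x \<in> carrier_vec N" "x \<noteq> 0\<^sub>v N" "M *\<^sub>v x = 0\<^sub>v N"
    using det_0_iff_vec_prod_zero_field[OF M] by auto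
  from x(1,2) obtain b0 where b0: "b0 < N" "x $ b0 \<noteq> 0"
    by (metis carrier_vecD eq_vecI index_zero_vec)
  obtain a where a: "a < N" "\<And>b. b < N \<Longrightarrow> norm (x $ b) \<le> norm (x $ a)"
  proof -
    let ?X = "(\<lambda>b. norm (x $ b)) ` {0..<N}"
    have "Max ?X \<in> ?X" using b0(1) by (intro Max_in) auto
    then obtain a where "a < N" "Max ?X = norm (x $ a)" by auto
    moreover have "norm (x $ b) \<le> Max ?X" if "b < N" for b using that by (intro Max_ge) auto
    ultimately show thesis using that by metis
  qed
  have pos: "0 < norm (x $ a)" using a(2)[OF b0(1)] b0(2)
    by (metis less_le_trans zero_less_norm_iff)
  have "0 = (M *\<^sub>v x) $ a" using x(3) a(1) by simp
  also have "\<dots> = (\<Sum>b\<in>{0..<N}. M $$ (a, b) * x $ b)"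
    using M x(1) a(1) by (simp add: scalar_prod_def)
  also have "\<dots> = M $$ (a, a) * x $ a + (\<Sum>b\<in>{0..<N} - {a}. M $$ (a, b) * x $ b)"
    using a(1) by (simp add: sum.remove)
  finally have "M $$ (a, a) * x $ a = - (\<Sum>b\<in>{0..<N} - {a}. M $$ (a, b) * x $ b)"
    by (simp add: eq_neg_iff_add_eq_0)
  from arg_cong[OF this, of norm]
  have "norm (M $$ (a, a)) * norm (x $ a) = norm (\<Sum>b\<in>{0..<N} - {a}. M $$ (a, b) * x $ b)"
    by (simp only: norm_minus_cancel norm_mult)
  also have "\<dots> \<le> (\<Sum>b\<in>{0..<N} - {a}. norm (M $$ (a, b)) * norm (x $ a))"
    by (rule sum_norm_le) (auto simp: norm_mult intro!: mult_left_mono a(2))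
  also have "\<dots> = (\<Sum>b\<in>{0..<N} - {a}. norm (M $$ (a, b))) * norm (x $ a)"
    by (simp add: sum_distrib_right)
  also have "\<dots> < norm (M $$ (a, a)) * norm (x $ a)"
    using dom[OF a(1)] pos by simp
  finally show False by simp
qed

section \<open>Collecting coefficients\<close>

text \<open>
  Both the coefficients of a tensor form and the rows of a Macaulay matrix arise by adding up given
  numbers \<open>a s\<close> over the fibres of a map \<open>f\<close> that sends an index to a monomial. Dominance of one
  number \<open>a s0\<close> over all others survives this summation if \<open>s0\<close> is alone in its fibre.
\<close>

lemma fibre_sum_point:
  assumes "finite S" "s0 \<in> S" "\<And>s. s \<in> S \<Longrightarrow> f s = b0 \<longleftrightarrow> s = s0"
  shows "(\<Sum>s\<in>S. a s when f s = b0) = a s0"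
proof -
  have "(\<Sum>s\<in>S. a s when f s = b0) = (\<Sum>s\<in>S. if s = s0 then a s else 0)"
    by (rule sum.cong) (use assms in \<open>auto simp: when_def\<close>)
  then show ?thesis using assms by simp
qed

lemma fibre_sum_norm_le:
  fixes a :: "'s \<Rightarrow> 'a::real_normed_vector"
  assumes "finite S" "finite B" "f s0 = b0"
  shows "(\<Sum>b\<in>B - {b0}. norm (\<Sum>s\<in>S. a s when f s = b)) \<le> (\<Sum>s\<in>S - {s0}. norm (a s))"
proof -
  have "(\<Sum>b\<in>B - {b0}. norm (\<Sum>s\<in>S. a s when f s = b))
      \<le> (\<Sum>b\<in>B - {b0}. \<Sum>s\<in>S. norm (a s) when f s = b)"
    by (intro sum_mono sum_norm_le) (simp add: when_def)
  also have "\<dots> = (\<Sum>s\<in>S. \<Sum>b\<in>B - {b0}. norm (a s) when f s = b)"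
    by (rule sum.swap)
  also have "\<dots> = (\<Sum>s\<in>S. if f s \<in> B - {b0} then norm (a s) else 0)"
    using assms(2) by (simp add: when_def)
  also have "\<dots> \<le> (\<Sum>s\<in>S. if s \<noteq> s0 then norm (a s) else 0)"
    by (rule sum_mono) (use assms(3) in auto)
  also have "\<dots> = (\<Sum>s\<in>S - {s0}. norm (a s))"
    using assms(1) by (simp add: sum.If_cases Diff_eq Collect_neg_eq)
  finally show ?thesis .
qed

section \<open>Macaulay matrices\<close>

lemma monoms_add: "\<mu> \<in> monoms n k \<Longrightarrow> \<nu> \<in> monoms n l \<Longrightarrow> \<mu> + \<nu> \<in> monoms n (k + l)"
  using keys_add[of \<mu> \<nu>] by (simp add: monoms_def mdeg_add) blast

lemma single_in_monoms: "i \<in> {1..n} \<Longrightarrow> Poly_Mapping.single i d \<in> monoms n d"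
  by (auto simp: monoms_def)

text \<open>
  The least degree in which every monomial in \<open>n\<close> variables is divisible by the \<open>d\<close>-th power of some
  variable.
\<close>

definition critical_degree :: "nat \<Rightarrow> nat \<Rightarrow> nat" where
  "critical_degree n d = n * (d - 1) + 1"

definition big_var :: "nat \<Rightarrow> nat \<Rightarrow> nat monom \<Rightarrow> nat" where
  "big_var n d \<alpha> = (SOME i. i \<in> {1..n} \<and> d \<le> Poly_Mapping.lookup \<alpha> i)"

lemma big_var:
  assumes "\<alpha> \<in> monoms n (critical_degree n d)" "d \<ge> 1"
  shows "big_var n d \<alpha> \<in> {1..n}" "d \<le> Poly_Mapping.lookup \<alpha> (big_var n d \<alpha>)"
proof -
  have "\<exists>i. i \<in> {1..n} \<and> d \<le> Poly_Mapping.lookup \<alpha> i"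
  proof (rule ccontr)
    assume "\<not> ?thesis"
    then have "Poly_Mapping.lookup \<alpha> i \<le> d - 1" if "i \<in> {1..n}" for i
    proof -
      have "\<not> d \<le> Poly_Mapping.lookup \<alpha> i" using that \<open>\<not> _\<close> by blast
      then show ?thesis by linarith
    qed
    then have "(\<Sum>i\<in>{1..n}. Poly_Mapping.lookup \<alpha> i) \<le> n * (d - 1)"
      using sum_bounded_above[of "{1..n}" "Poly_Mapping.lookup \<alpha>" "d - 1"] by simp
    moreover have "(\<Sum>i\<in>{1..n}. Poly_Mapping.lookup \<alpha> i) = mdeg \<alpha>"
      using assms by (subst mdeg_superset[of "{1..n}"]) (auto simp: monoms_def)
    ultimately show False using assms by (simp add: monoms_def critical_degree_def)
  qed
  from someI_ex[OF this] show "big_var n d \<alpha> \<in> {1..n}" "d \<le> Poly_Mapping.lookup \<alpha> (big_var n d \<alpha>)"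
    unfolding big_var_def by auto
qed

text \<open>The monomial \<open>x\<^sup>\<alpha> / x\<^sub>i\<^sup>d\<close> for the chosen variable \<open>x\<^sub>i\<close> of high exponent.\<close>

definition reduced :: "nat \<Rightarrow> nat \<Rightarrow> nat monom \<Rightarrow> nat monom" where
  "reduced n d \<alpha> = \<alpha> - Poly_Mapping.single (big_var n d \<alpha>) d"

lemma reduced_add:
  assumes "\<alpha> \<in> monoms n (critical_degree n d)" "d \<ge> 1"
  shows "reduced n d \<alpha> + Poly_Mapping.single (big_var n d \<alpha>) d = \<alpha>"
  by (rule poly_mapping_eqI)
    (use big_var(2)[OF assms] in \<open>auto simp: reduced_def lookup_add lookup_minus lookup_single when_def\<close>)

lemma reduced_add_in_monoms:
  assumes \<alpha>: "\<alpha> \<in> monoms n (critical_degree n d)" and d: "d \<ge> 1" and \<beta>: "\<beta> \<in> monoms n d"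
  shows "reduced n d \<alpha> + \<beta> \<in> monoms n (critical_degree n d)"
proof -
  have eq: "mdeg (reduced n d \<alpha>) + d = critical_degree n d"
    using arg_cong[OF reduced_add[OF \<alpha> d], of mdeg] \<alpha> by (simp add: mdeg_add monoms_def)
  have "Poly_Mapping.keys (reduced n d \<alpha>) \<subseteq> Poly_Mapping.keys \<alpha>"
    by (auto simp: reduced_def in_keys_iff lookup_minus)
  then have "reduced n d \<alpha> \<in> monoms n (mdeg (reduced n d \<alpha>))"
    using \<alpha> by (auto simp: monoms_def)
  from monoms_add[OF this \<beta>] show ?thesis by (simp add: eq)
qed

text \<open>
  The coefficient at \<open>x\<^sup>\<gamma>\<close> of the generic form \<open>\<sigma>(i)\<close> times \<open>x\<^sup>\<alpha> / x\<^sub>i\<^sup>d\<close>, where \<open>x\<^sub>i\<close> is the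
  variable chosen for \<open>\<alpha>\<close>.
\<close>

definition macaulay_entry :: "nat \<Rightarrow> nat \<Rightarrow> (nat \<Rightarrow> nat) \<Rightarrow> nat monom \<Rightarrow> nat monom \<Rightarrow> (coeff_var, int) mpol" where
  "macaulay_entry n d \<sigma> \<alpha> \<gamma> =
     (\<Sum>\<beta>\<in>monoms n d. var (\<sigma> (big_var n d \<alpha>), \<beta>) when reduced n d \<alpha> + \<beta> = \<gamma>)"

lemma single_sum: "Poly_Mapping.single k (\<Sum>x\<in>X. f x) = (\<Sum>x\<in>X. Poly_Mapping.single k (f x))"
  by (induction X rule: infinite_finite_induct) (simp_all add: single_add)

lemma macaulay_row:
  assumes \<alpha>: "\<alpha> \<in> monoms n (critical_degree n d)" and d: "d \<ge> 1"
  shows "Poly_Mapping.single (reduced n d \<alpha>) 1 * generic_form n d (\<sigma> (big_var n d \<alpha>)) =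
    (\<Sum>\<gamma>\<in>monoms n (critical_degree n d). Poly_Mapping.single \<gamma> (macaulay_entry n d \<sigma> \<alpha> \<gamma>))"
proof -
  let ?v = "\<lambda>\<beta>. var (\<sigma> (big_var n d \<alpha>), \<beta>) :: (coeff_var, int) mpol"
  have "(\<Sum>\<gamma>\<in>monoms n (critical_degree n d). Poly_Mapping.single \<gamma> (macaulay_entry n d \<sigma> \<alpha> \<gamma>)) =
    (\<Sum>\<gamma>\<in>monoms n (critical_degree n d). \<Sum>\<beta>\<in>monoms n d.
       if reduced n d \<alpha> + \<beta> = \<gamma> then Poly_Mapping.single \<gamma> (?v \<beta>) else 0)"
    unfolding macaulay_entry_def single_sum
    by (intro sum.cong refl) (simp add: when_def)
  also have "\<dots> = (\<Sum>\<beta>\<in>monoms n d. \<Sum>\<gamma>\<in>monoms n (critical_degree n d).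
       if reduced n d \<alpha> + \<beta> = \<gamma> then Poly_Mapping.single \<gamma> (?v \<beta>) else 0)"
    by (rule sum.swap)
  also have "\<dots> = (\<Sum>\<beta>\<in>monoms n d. Poly_Mapping.single (reduced n d \<alpha> + \<beta>) (?v \<beta>))"
    by (intro sum.cong refl) (simp add: finite_monoms reduced_add_in_monoms[OF \<alpha> d])
  also have "\<dots> = Poly_Mapping.single (reduced n d \<alpha>) 1 * generic_form n d (\<sigma> (big_var n d \<alpha>))"
    by (simp add: generic_form_def sum_distrib_left mult_single)
  finally show ?thesis by simp
qed

text \<open>
  The selection \<open>\<sigma>\<close> of a form for each variable is left free: the identity gives the value \<open>1\<close> at the
  pure powers, while a dominated system calls for the selection of its dominated forms. The
  enumeration \<open>e\<close> of the monomials turns monomials into matrix indices.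
\<close>

locale macaulay =
  fixes n d N :: nat and \<sigma> :: "nat \<Rightarrow> nat" and e :: "nat \<Rightarrow> nat monom"
  assumes d: "d \<ge> 1"
    and \<sigma>: "\<And>i. i \<in> {1..n} \<Longrightarrow> \<sigma> i \<in> {1..n}"
    and e: "bij_betw e {0..<N} (monoms n (critical_degree n d))"
begin

definition M :: "(coeff_var, int) mpol mat" where
  "M = mat N N (\<lambda>(a, b). macaulay_entry n d \<sigma> (e a) (e b))"

lemma M_carrier: "M \<in> carrier_mat N N"
  by (simp add: M_def)

lemma e_mem: "a < N \<Longrightarrow> e a \<in> monoms n (critical_degree n d)"
  using e by (auto simp: bij_betw_def)

text \<open>
  Cramer's rule: the rows of \<open>M\<close> are multiples of the generic forms, and row \<open>b\<close> of the adjugate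
  combines them to \<open>det M\<close> times the \<open>b\<close>-th monomial.
\<close>

lemma det_inertia_form: "inertia_form n d (det M)"
  unfolding inertia_form_def
proof (intro exI[of _ "critical_degree n d"] ballI)
  fix \<gamma> assume "\<gamma> \<in> monoms n (critical_degree n d)"
  then have "\<gamma> \<in> e ` {0..<N}" using bij_betw_imp_surj_on[OF e] by simp
  then obtain b where b: "b < N" "\<gamma> = e b" by auto
  let ?v = "\<lambda>a. big_var n d (e a)"
  define w where "w a = Poly_Mapping.single 0 (adj_mat M $$ (b, a)) * Poly_Mapping.single (reduced n d (e a)) 1" for a
  have adj: "(\<Sum>a\<in>{0..<N}. adj_mat M $$ (b, a) * M $$ (a, b')) = (if b = b' then det M else 0)"
    if "b' < N" for b'
  proof -
    have "(\<Sum>a\<in>{0..<N}. adj_mat M $$ (b, a) * M $$ (a, b')) = (adj_mat M * M) $$ (b, b')"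
      using b(1) that M_carrier adj_mat(1)[OF M_carrier] by (simp add: scalar_prod_def)
    also have "\<dots> = (if b = b' then det M else 0)"
      using b(1) that unfolding adj_mat(3)[OF M_carrier] by simp
    finally show ?thesis .
  qed
  have "(\<Sum>a\<in>{0..<N}. w a * generic_form n d (\<sigma> (?v a))) =
      (\<Sum>a\<in>{0..<N}. \<Sum>b'\<in>{0..<N}. Poly_Mapping.single (e b') (adj_mat M $$ (b, a) * M $$ (a, b')))"
  proof (rule sum.cong[OF refl])
    fix a assume a: "a \<in> {0..<N}"
    then have "w a * generic_form n d (\<sigma> (?v a)) = Poly_Mapping.single 0 (adj_mat M $$ (b, a)) *
      (\<Sum>\<gamma>\<in>monoms n (critical_degree n d). Poly_Mapping.single \<gamma> (macaulay_entry n d \<sigma> (e a) \<gamma>))"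
      unfolding w_def mult.assoc by (subst macaulay_row[OF e_mem d]) auto
    also have "\<dots> = Poly_Mapping.single 0 (adj_mat M $$ (b, a)) *
      (\<Sum>b'\<in>{0..<N}. Poly_Mapping.single (e b') (macaulay_entry n d \<sigma> (e a) (e b')))"
      by (subst sum.reindex_bij_betw[OF e, symmetric]) simp
    also have "\<dots> = (\<Sum>b'\<in>{0..<N}. Poly_Mapping.single (e b') (adj_mat M $$ (b, a) * M $$ (a, b')))"
      using a by (simp add: sum_distrib_left mult_single M_def)
    finally show "w a * generic_form n d (\<sigma> (?v a)) = \<dots>" .
  qed
  also have "\<dots> = (\<Sum>b'\<in>{0..<N}. Poly_Mapping.single (e b') (\<Sum>a\<in>{0..<N}. adj_mat M $$ (b, a) * M $$ (a, b')))"
    by (subst sum.swap) (simp add: single_sum)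
  also have "\<dots> = (\<Sum>b'\<in>{0..<N}. if b = b' then Poly_Mapping.single (e b') (det M) else 0)"
    by (rule sum.cong) (simp_all add: adj)
  also have "\<dots> = Poly_Mapping.single \<gamma> (det M)"
    using b by simp
  finally have eq: "Poly_Mapping.single \<gamma> (det M) = (\<Sum>a\<in>{0..<N}. w a * generic_form n d (\<sigma> (?v a)))"
    by simp
  \<comment> \<open>Different rows may use the same form; their multipliers are collected in \<open>q\<close>.\<close>
  define q where "q i = (\<Sum>a | a \<in> {0..<N} \<and> \<sigma> (?v a) = i. w a)" for i
  have "(\<Sum>a\<in>{0..<N}. w a * generic_form n d (\<sigma> (?v a))) =
     (\<Sum>i\<in>{1..n}. \<Sum>a | a \<in> {0..<N} \<and> \<sigma> (?v a) = i. w a * generic_form n d (\<sigma> (?v a)))"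
    by (rule sum.group[symmetric]) (use \<sigma> big_var(1)[OF e_mem d] in auto)
  also have "\<dots> = (\<Sum>i\<in>{1..n}. q i * generic_form n d i)"
    unfolding q_def sum_distrib_right by (intro sum.cong) auto
  finally show "\<exists>q. Poly_Mapping.single \<gamma> (det M) = (\<Sum>i\<in>{1..n}. q i * generic_form n d i)"
    using eq by auto
qed

lemma peval_det: "peval c (det M) = det (map_mat (peval c) M)"
  by (simp add: peval.hom_det)

lemma peval_M:
  assumes "a < N" "b < N"
  shows "map_mat (peval c) M $$ (a, b) =
    (\<Sum>\<beta>\<in>monoms n d. c (\<sigma> (big_var n d (e a)), \<beta>) when reduced n d (e a) + \<beta> = e b)"
proof -
  have [simp]: "peval c (p when P) = (peval c p when P)" for p P
    by (simp add: when_def)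
  show ?thesis using assms by (simp add: M_def macaulay_entry_def peval_sum peval_var)
qed

text \<open>
  This makes the diagonal entry of row \<open>a\<close> a single coefficient, the one at the pure power.
\<close>

lemma reduced_eq_iff:
  assumes "a < N"
  shows "reduced n d (e a) + \<beta> = e a \<longleftrightarrow> \<beta> = Poly_Mapping.single (big_var n d (e a)) d"
  using reduced_add[OF e_mem[OF assms] d] by (metis add_left_cancel)

lemma peval_det_nonzero:
  fixes c :: "coeff_var \<Rightarrow> 'a::real_normed_field"
  assumes dom: "\<And>i. i \<in> {1..n} \<Longrightarrow>
    (\<Sum>\<beta>\<in>monoms n d - {Poly_Mapping.single i d}. norm (c (\<sigma> i, \<beta>))) < norm (c (\<sigma> i, Poly_Mapping.single i d))"
  shows "peval c (det M) \<noteq> 0"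
  unfolding peval_det
proof (rule det_diagonally_dominant_nonzero)
  show "map_mat (peval c) M \<in> carrier_mat N N" using M_carrier by simp
  fix a assume a: "a < N"
  define i where "i = big_var n d (e a)"
  have i: "i \<in> {1..n}" unfolding i_def by (rule big_var(1)[OF e_mem[OF a] d])
  let ?f = "\<lambda>\<gamma>. \<Sum>\<beta>\<in>monoms n d. c (\<sigma> i, \<beta>) when reduced n d (e a) + \<beta> = \<gamma>"
  have "(\<Sum>b\<in>{0..<N} - {a}. norm (map_mat (peval c) M $$ (a, b))) = (\<Sum>b\<in>{0..<N} - {a}. norm (?f (e b)))"
    by (rule sum.cong) (simp_all add: peval_M a i_def del: index_map_mat)
  also have "\<dots> = (\<Sum>\<gamma>\<in>monoms n (critical_degree n d) - {e a}. norm (?f \<gamma>))"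
    by (rule sum.reindex_bij_betw, rule bij_betw_DiffI[OF e]) (use a e in \<open>auto simp: bij_betw_def\<close>)
  also have "\<dots> \<le> (\<Sum>\<beta>\<in>monoms n d - {Poly_Mapping.single i d}. norm (c (\<sigma> i, \<beta>)))"
    by (rule fibre_sum_norm_le) (simp_all add: finite_monoms reduced_eq_iff[OF a] i_def)
  also have "\<dots> < norm (c (\<sigma> i, Poly_Mapping.single i d))" by (rule dom[OF i])
  also have "c (\<sigma> i, Poly_Mapping.single i d) = ?f (e a)"
    by (rule fibre_sum_point[symmetric])
      (simp_all add: finite_monoms single_in_monoms[OF i] reduced_eq_iff[OF a, folded i_def])
  also have "\<dots> = map_mat (peval c) M $$ (a, a)" by (simp add: peval_M a i_def del: index_map_mat)
  finally show "(\<Sum>b\<in>{0..<N} - {a}. norm (map_mat (peval c) M $$ (a, b))) < norm (map_mat (peval c) M $$ (a, a))" .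
qed

lemma peval_det_powers:
  assumes "\<And>i. i \<in> {1..n} \<Longrightarrow> \<sigma> i = i"
  shows "peval (\<lambda>(i, \<alpha>). if \<alpha> = Poly_Mapping.single i d then 1 else 0 :: int) (det M) = 1"
proof -
  let ?c = "\<lambda>(i, \<alpha>). if \<alpha> = Poly_Mapping.single i d then 1 else 0 :: int"
  have "map_mat (peval ?c) M = 1\<^sub>m N"
  proof (rule eq_matI)
    fix a b assume "a < dim_row (1\<^sub>m N :: int mat)" "b < dim_col (1\<^sub>m N :: int mat)"
    then have ab: "a < N" "b < N" by auto
    define i where "i = big_var n d (e a)"
    have i: "i \<in> {1..n}" unfolding i_def by (rule big_var(1)[OF e_mem[OF ab(1)] d])
    have "map_mat (peval ?c) M $$ (a, b) =
      (\<Sum>\<beta>\<in>monoms n d. (if \<beta> = Poly_Mapping.single i d then 1 else 0) when reduced n d (e a) + \<beta> = e b)"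
      using assms[OF i] by (simp add: peval_M ab i_def del: index_map_mat)
    also have "\<dots> = (\<Sum>\<beta>\<in>monoms n d. if \<beta> = Poly_Mapping.single i d then (1 when e a = e b) else 0)"
      by (rule sum.cong) (auto simp: i_def reduced_add[OF e_mem[OF ab(1)] d])
    also have "\<dots> = (1 when e a = e b)"
      using single_in_monoms[OF i] by (simp add: finite_monoms)
    also have "\<dots> = 1\<^sub>m N $$ (a, b)"
      using ab e by (auto simp: when_def bij_betw_def inj_on_def)
    finally show "map_mat (peval ?c) M $$ (a, b) = 1\<^sub>m N $$ (a, b)" .
  qed (use M_carrier in auto)
  then show ?thesis by (simp add: peval_det)
qed

end

section \<open>The resultant\<close>

text \<open>
  The Macaulay determinant bounds the degrees of the common divisors, so a maximal one exists, and its
  value at the pure powers forces the value of any divisor there to be a unit of \<open>\<int>\<close>.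
\<close>

lemma ex_is_resultant:
  assumes "d \<ge> 1"
  shows "\<exists>R. is_resultant n d R"
proof -
  define c :: "coeff_var \<Rightarrow> int" where "c = (\<lambda>(i, \<alpha>). if \<alpha> = Poly_Mapping.single i d then 1 else 0)"
  define common where "common S \<longleftrightarrow> (\<forall>T. inertia_form n d T \<longrightarrow> S dvd T)" for S
  obtain e where e: "bij_betw e {0..<card (monoms n (critical_degree n d))} (monoms n (critical_degree n d))"
    using ex_bij_betw_nat_finite[OF finite_monoms] by blast
  interpret macaulay n d "card (monoms n (critical_degree n d))" id e
    by unfold_locales (use assms e in auto)
  have one: "peval c (det M) = 1" unfolding c_def by (rule peval_det_powers) simp
  then have nz: "det M \<noteq> 0" by (metis peval_zero zero_neq_one)
  have "\<exists>R. common R \<and> (\<forall>S. common S \<longrightarrow> tdeg S \<le> tdeg R)"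
  proof (rule ex_has_greatest_nat)
    show "common 1" by (simp add: common_def)
    show "\<forall>S. common S \<longrightarrow> tdeg S < Suc (tdeg (det M))"
      using det_inertia_form nz by (auto simp: common_def less_Suc_eq_le intro: tdeg_le_if_dvd)
  qed
  then obtain R where R: "common R" "\<And>S. common S \<Longrightarrow> tdeg S \<le> tdeg R" by blast
  have "R dvd det M" using R(1) det_inertia_form by (simp add: common_def)
  then obtain Q where "det M = R * Q" by (rule dvdE)
  with one have "peval c R * peval c Q = 1" by (simp only: peval_mult)
  then have "\<bar>peval c R\<bar> = 1" using abs_zmult_eq_1[of "peval c R" "peval c Q"] by simp
  then have "peval c R = 1 \<or> peval c (- R) = 1"
    unfolding peval.hom_uminus by linarith
  moreover have "common (- R)" "tdeg (- R) = tdeg R"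
    using R(1) by (auto simp: common_def tdeg_uminus)
  \<comment> \<open>The sign of \<open>R\<close> is the only freedom left; one of \<open>R\<close> and \<open>- R\<close> is normalised.\<close>
  ultimately show ?thesis
    using R unfolding is_resultant_def common_def[symmetric] c_def[symmetric] by metis
qed

lemma resultant_poly_dvd_inertia_form:
  assumes "d \<ge> 1" "inertia_form n d T"
  shows "resultant_poly n d dvd T"
  using someI_ex[OF ex_is_resultant[OF assms(1), of n]] assms(2)
  by (simp add: resultant_poly_def is_resultant_def)

lemma form_resultant_nonzero:
  assumes d: "d \<ge> 1"
    and dom: "\<And>i. i \<in> {1..n} \<Longrightarrow> \<exists>j\<in>{1..n}.
      (\<Sum>\<beta>\<in>monoms n d - {Poly_Mapping.single i d}. cmod (Poly_Mapping.lookup (F j) \<beta>))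
        < cmod (Poly_Mapping.lookup (F j) (Poly_Mapping.single i d))"
  shows "form_resultant n d F \<noteq> 0"
proof -
  obtain \<sigma> where row: "\<And>i. i \<in> {1..n} \<Longrightarrow> \<sigma> i \<in> {1..n}"
    "\<And>i. i \<in> {1..n} \<Longrightarrow> 
      (\<Sum>\<beta>\<in>monoms n d - {Poly_Mapping.single i d}. cmod (Poly_Mapping.lookup (F (\<sigma> i)) \<beta>))
        < cmod (Poly_Mapping.lookup (F (\<sigma> i)) (Poly_Mapping.single i d))"
    using dom by metis
  obtain e where e: "bij_betw e {0..<card (monoms n (critical_degree n d))} (monoms n (critical_degree n d))"
    using ex_bij_betw_nat_finite[OF finite_monoms] by blast
  interpret macaulay n d "card (monoms n (critical_degree n d))" \<sigma> e
    by unfold_locales (use d row(1) e in auto)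
  let ?c = "\<lambda>(i, \<alpha>). Poly_Mapping.lookup (F i) \<alpha>"
  have "peval ?c (det M) \<noteq> 0"
    by (rule peval_det_nonzero) (use row(2) in simp)
  moreover have "resultant_poly n d dvd det M"
    by (rule resultant_poly_dvd_inertia_form[OF d det_inertia_form])
  ultimately show ?thesis
    unfolding form_resultant_def by (metis dvdE peval_mult mult_zero_left)
qed

section \<open>Tensors\<close>

definition list_monom :: "nat list \<Rightarrow> nat monom" where
  "list_monom is = (\<Sum>j\<leftarrow>is. Poly_Mapping.single j 1)"

lemma prod_list_var: "(\<Prod>j\<leftarrow>is. var j) = (Poly_Mapping.single (list_monom is) 1 :: (nat, complex) mpol)"
  by (induction "is") (simp_all add: list_monom_def var_def mult_single)

lemma lookup_list_monom: "Poly_Mapping.lookup (list_monom is) v = count_list is v"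
  by (induction "is") (simp_all add: list_monom_def lookup_add lookup_single when_def)

lemma list_monom_replicate: "list_monom (replicate k i) = Poly_Mapping.single i k"
  by (induction k) (simp_all add: list_monom_def single_add[symmetric])

lemma list_monom_eq_single_iff:
  assumes "length is = k"
  shows "list_monom is = Poly_Mapping.single i k \<longleftrightarrow> is = replicate k i"
proof
  assume eq: "list_monom is = Poly_Mapping.single i k"
  have "j = i" if "j \<in> set is" for j
  proof (rule ccontr)
    assume "j \<noteq> i"
    then have "count_list is j = 0"
      using eq by (metis lookup_list_monom lookup_single_not_eq)
    then show False using that by (simp add: count_list_0_iff)
  qed
  then show "is = replicate k i" using assms by (simp add: replicate_eqI)
next
  assume "is = replicate k i"
  then show "list_monom is = Poly_Mapping.single i k"
    by (simp add: list_monom_replicate)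
qed

lemma lookup_tensor_form:
  "Poly_Mapping.lookup (tensor_form m n A j) \<beta> =
    (\<Sum>is\<in>indices n (m - 1). A (j # is) when list_monom is = \<beta>)"
  by (simp add: tensor_form_def prod_list_var const_def mult_single lookup_sum lookup_single)

lemma tensor_form_dominated:
  assumes i: "i \<in> {1..n}"
    and dom: "(\<Sum>is\<in>indices n (m - 1) - {replicate (m - 1) i}. cmod (A (j # is)))
      < cmod (A (j # replicate (m - 1) i))"
  shows "(\<Sum>\<beta>\<in>monoms n (m - 1) - {Poly_Mapping.single i (m - 1)}. cmod (Poly_Mapping.lookup (tensor_form m n A j) \<beta>))
    < cmod (Poly_Mapping.lookup (tensor_form m n A j) (Poly_Mapping.single i (m - 1)))"
proof -
  have "Poly_Mapping.lookup (tensor_form m n A j) (Poly_Mapping.single i (m - 1)) = A (j # replicate (m - 1) i)"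
    unfolding lookup_tensor_form
  proof (rule fibre_sum_point[OF finite_indices])
    show "replicate (m - 1) i \<in> indices n (m - 1)" using i by (auto simp: indices_def)
    show "list_monom is = Poly_Mapping.single i (m - 1) \<longleftrightarrow> is = replicate (m - 1) i"
      if "is \<in> indices n (m - 1)" for "is"
      using that by (intro list_monom_eq_single_iff) (simp add: indices_def)
  qed
  moreover have "(\<Sum>\<beta>\<in>monoms n (m - 1) - {Poly_Mapping.single i (m - 1)}. cmod (Poly_Mapping.lookup (tensor_form m n A j) \<beta>))
    \<le> (\<Sum>is\<in>indices n (m - 1) - {replicate (m - 1) i}. cmod (A (j # is)))"
    unfolding lookup_tensor_form
    by (rule fibre_sum_norm_le[OF finite_indices finite_monoms]) (simp add: list_monom_eq_single_iff)
  ultimately show ?thesis using dom by simp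
qed

text \<open>
  Exchanging which entry is left out of an absolute row sum turns the inequality
  \<open>|a\<^bsub>j\<dots>j\<^esub>| < 2 |a\<^bsub>ji\<dots>i\<^esub>| - r\<^sub>j\<close> into dominance of \<open>a\<^bsub>ji\<dots>i\<^esub>\<close> over the other entries
  with first index \<open>j\<close>.
\<close>

lemma sum_other_entries:
  assumes "i \<in> {1..n}" "j \<in> {1..n}"
  shows "(\<Sum>is\<in>indices n k - {replicate k i}. cmod (A (j # is))) + cmod (A (j # replicate k i)) =
    (\<Sum>is\<in>indices n k - {replicate k j}. cmod (A (j # is))) + cmod (A (j # replicate k j))"
proof -
  have "replicate k l \<in> indices n k" if "l \<in> {1..n}" for l
    using that by (auto simp: indices_def)
  then show ?thesis
    using assms by (simp add: sum_diff1 finite_indices)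
qed

theorem corollary1:
  fixes m n :: nat and A :: tensor
  assumes "m \<ge> 2" and "n \<ge> 1"
    and "\<forall>i\<in>{1..n}.
           cmod (A (replicate m i)) > row_sum m n A i \<or>
           (\<exists>j\<in>{1..n}. j \<noteq> i \<and>
              cmod (A (replicate m j)) < 2 * cmod (A (j # replicate (m - 1) i)) - row_sum m n A j)"
  shows "tensor_det m n A \<noteq> 0"
  unfolding tensor_det_def
proof (rule form_resultant_nonzero)
  show "1 \<le> m - 1" using assms(1) by simp
  fix i assume i: "i \<in> {1..n}"
  have diag: "A (replicate m j) = A (j # replicate (m - 1) j)" for j
    using assms(1) by (cases m) auto
  have "\<exists>j\<in>{1..n}. (\<Sum>is\<in>indices n (m - 1) - {replicate (m - 1) i}. cmod (A (j # is)))
      < cmod (A (j # replicate (m - 1) i))"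
  proof (cases "cmod (A (replicate m i)) > row_sum m n A i")
    case True
    then show ?thesis using i by (auto simp: row_sum_def diag)
  next
    case False
    then obtain j where j: "j \<in> {1..n}" "j \<noteq> i"
      "cmod (A (replicate m j)) < 2 * cmod (A (j # replicate (m - 1) i)) - row_sum m n A j"
      using assms(3) i by blast
    then show ?thesis
      using sum_other_entries[of i n j A "m - 1"] i assms(1)
      by (intro bexI[of _ j]) (auto simp: row_sum_def diag)
  qed
  then show "\<exists>j\<in>{1..n}.
      (\<Sum>\<beta>\<in>monoms n (m - 1) - {Poly_Mapping.single i (m - 1)}. cmod (Poly_Mapping.lookup (tensor_form m n A j) \<beta>))
        < cmod (Poly_Mapping.lookup (tensor_form m n A j) (Poly_Mapping.single i (m - 1)))"
    using tensor_form_dominated[OF i] by blast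
qed

end
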